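(* Let $X:\mathbb{R}\to\mathbb{R}^2$ be an affine self-similar solution of the affine curve shortening flow satisfying $$\langle BX+C,N_X\rangle=k_X^{1/3},$$ where $B\in\mathbb{R}^{2\times 2}$ and $C\in\mathbb{R}^2$. Then there is an affine transformation $Y=QX+H$ of $X$ with $Q\in GL(2,\mathbb{R})$ and $H\in\mathbb{R}^2$ such that $Y$ satisfies one of the following equations, according to the following cases. (1) The case $\det B=0$ (degenerate case). Let $R(B)$ denote the range of $B$. (a) If $B=0$, then $\left\langle\begin{pmatrix}0\\1\end{pmatrix},N_Y\right\rangle=k_Y^{1/3}$. (b) If $B\neq 0$ has a positive eigenvalue and $C\in R(B)$, then $\left\langle\begin{pmatrix}0&0\\0&1\end{pmatrix}Y,N_Y\right\rangle=k_Y^{1/3}$. (c) If $B\neq 0$ has a positive eigenvalue and $C\notin R(B)$, then $\left\langle\begin{pmatrix}0&0\\0&1\end{pmatrix}Y+\begin{pmatrix}1\\0\end{pmatrix},N_Y\right\rangle=k_Y^{1/3}$. (d) If $B\neq 0$ has a negative eigenvalue and $C\in R(B)$, then $\left\langle\begin{pmatrix}0&0\\0&-1\end{pmatrix}Y,N_Y\right\rangle=k_Y^{1/3}$. (e) If $B\neq 0$ has a negative eigenvalue and $C\notin R(B)$, then $\left\langle\begin{pmatrix}0&0\\0&-1\end{pmatrix}Y+\begin{pmatrix}1\\0\end{pmatrix},N_Y\right\rangle=k_Y^{1/3}$. (f) If $B\neq 0$ has two zero eigenvalues and $C\in R(B)$, then $\left\langle\begin{pmatrix}0&1\\0&0\end{pmatrix}Y,N_Y\right\rangle=k_Y^{1/3}$.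 (g) If $B\neq 0$ has two zero eigenvalues and $C\notin R(B)$, then $\left\langle\begin{pmatrix}0&1\\0&0\end{pmatrix}Y+\begin{pmatrix}0\\1\end{pmatrix},N_Y\right\rangle=k_Y^{1/3}$. (2) The case $\det B\neq 0$ (nondegenerate case). Let $\Delta=(\operatorname{tr}B)^2-4\det B$ be the discriminant of the characteristic polynomial of $B$, and let $J=\begin{pmatrix}0&-1\\1&0\end{pmatrix}$. (a) If $\Delta<0$ and $\operatorname{tr}B=0$, then $\langle JY,N_Y\rangle=k_Y^{1/3}$. (b) If $\Delta<0$ and $\operatorname{tr}B>0$, then $\langle Y+aJY,N_Y\rangle=k_Y^{1/3}$ with some $a>0$. (c) If $\Delta<0$ and $\operatorname{tr}B<0$, then $\langle -Y+aJY,N_Y\rangle=k_Y^{1/3}$ with some $a>0$. (d) If $\Delta=0$ and $B$ is diagonalizable with a double positive eigenvalue, then $\langle Y,N_Y\rangle=k_Y^{1/3}$. (e) If $\Delta=0$ and $B$ is diagonalizable with a double negative eigenvalue, then $-\langle Y,N_Y\rangle=k_Y^{1/3}$. (f) If $\Delta=0$ and $B$ is not diagonalizable with a double positive eigenvalue, then $\left\langle\begin{pmatrix}1&1\\0&1\end{pmatrix}Y,N_Y\right\rangle=k_Y^{1/3}$. (g) If $\Delta=0$ and $B$ is not diagonalizable with a double negative eigenvalue, then $\left\langle\begin{pmatrix}-1&1\\0&-1\end{pmatrix}Y,N_Y\right\rangle=k_Y^{1/3}$. (h) If $\Delta>0$, $\det B>0$ and $B$ has two different positive eigenvalues, then $\left\langle\begin{pmatrix}a&0\\0&1\end{pmatrix}Y,N_Y\right\rangle=k_Y^{1/3}$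 with some $0<a<1$. (i) If $\Delta>0$, $\det B>0$ and $B$ has two different negative eigenvalues, then $-\left\langle\begin{pmatrix}a&0\\0&1\end{pmatrix}Y,N_Y\right\rangle=k_Y^{1/3}$ with some $0<a<1$. (j) If $\Delta>0$ and $\det B<0$, then $\left\langle\begin{pmatrix}-a&0\\0&1\end{pmatrix}Y,N_Y\right\rangle=k_Y^{1/3}$ with some $a>0$.
   Context: Curves are smooth immersed curves in the Euclidean plane $\mathbb{R}^2$. For a curve $X=X(u)$, put $T=X_u/\|X_u\|$, $N_X=JT$ with $J=\begin{pmatrix}0&-1\\1&0\end{pmatrix}$ (unit normal), and $k_X=\det(X_u,X_{uu})/\|X_u\|^3$ (curvature with respect to $N_X$). $\langle\cdot,\cdot\rangle$ is the Euclidean inner product and $k^{1/3}$ is the real (odd) cube root. The affine curve shortening flow (ACSF) is the evolution equation $\hat X_t=\hat k^{1/3}\hat N$ for families of curves $\hat X(t,u)$, where $\hat N$ and $\hat k$ are the unit normal and curvature of $\hat X(t,\cdot)$. A family is a solution up to reparametrization if $\langle\hat X_t,\hat N\rangle=\hat k^{1/3}$. A curve $X:\mathbb{R}\to\mathbb{R}^2$ is an affine self-similar solution of the ACSF if there is a curve $(A(t),H(t))$, $t\in[0,T)$ with $T>0$, in the group of affine transformations of $\mathbb{R}^2$, with $A(0)=I_2$ and $H(0)=0$, such that $\hat X(t,u)=A(t)X(u)+H(t)$ is a solution of the ACSF up to reparametrization. *)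

theory Defs
  imports "HOL-Analysis.Analysis" "HOL-Computational_Algebra.Polynomial"
begin

abbreviation vec2 :: "real \<Rightarrow> real \<Rightarrow> real^2" where
  "vec2 a b \<equiv> vector [a, b]"

text \<open>The matrix with rows \<open>(a, b)\<close> and \<open>(c, d)\<close>.\<close>

abbreviation mat22 :: "real \<Rightarrow> real \<Rightarrow> real \<Rightarrow> real \<Rightarrow> real^2^2" where
  "mat22 a b c d \<equiv> vector [vector [a, b], vector [c, d]]"

definition rotJ :: "real^2^2" where
  "rotJ = mat22 0 (-1) 1 0"


section \<open>Linear algebra\<close>

definition eigenvalue :: "real^'n^'n \<Rightarrow> real \<Rightarrow> bool" where
  "eigenvalue A l \<longleftrightarrow> (\<exists>v. v \<noteq> 0 \<and> A *v v = l *\<^sub>R v)"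

definition charpoly :: "real^'n^'n \<Rightarrow> real poly" where
  "charpoly A = det (\<chi> i j. (if i = j then [:0, 1:] else 0) - [:A $ i $ j:])"

text \<open>Algebraic multiplicity two.\<close>

definition double_eigenvalue :: "real^'n^'n \<Rightarrow> real \<Rightarrow> bool" where
  "double_eigenvalue A l \<longleftrightarrow> order l (charpoly A) = 2"

text \<open>Diagonalizability over the reals.\<close>

definition diagonalizable :: "real^'n^'n \<Rightarrow> bool" where
  "diagonalizable A \<longleftrightarrow>
    (\<exists>P D :: real^'n^'n. invertible P \<and> (\<forall>i j. i \<noteq> j \<longrightarrow> D $ i $ j = 0) \<and> A = P ** D ** matrix_inv P)"


section \<open>Smooth immersed plane curves\<close>

text \<open>
  The function \<open>D n\<close> is the \<open>n\<close>-th derivative; at an end point belonging to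
  the interval \<open>S\<close> the derivatives are one-sided.
\<close>

definition smooth_on :: "real set \<Rightarrow> (real \<Rightarrow> 'a::real_normed_vector) \<Rightarrow> bool" where
  "smooth_on S f \<longleftrightarrow>
    (\<exists>D :: nat \<Rightarrow> real \<Rightarrow> 'a. D 0 = f \<and>
      (\<forall>n. \<forall>t\<in>S. (D n has_vector_derivative D (Suc n) t) (at t within S)))"

definition deriv1 :: "(real \<Rightarrow> real^2) \<Rightarrow> real \<Rightarrow> real^2" where
  "deriv1 X u = vector_derivative X (at u)"

definition deriv2 :: "(real \<Rightarrow> real^2) \<Rightarrow> real \<Rightarrow> real^2" where
  "deriv2 X u = vector_derivative (deriv1 X) (at u)"

definition plane_curve :: "(real \<Rightarrow> real^2) \<Rightarrow> bool" where
  "plane_curve X \<longleftrightarrow> smooth_on UNIV X \<and> (\<forall>u. deriv1 X u \<noteq> 0)"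

definition unit_tangent :: "(real \<Rightarrow> real^2) \<Rightarrow> real \<Rightarrow> real^2" where
  "unit_tangent X u = deriv1 X u /\<^sub>R norm (deriv1 X u)"

definition unit_normal :: "(real \<Rightarrow> real^2) \<Rightarrow> real \<Rightarrow> real^2" where
  "unit_normal X u = rotJ *v unit_tangent X u"

text \<open>The two vectors are the rows here, which does not change the determinant.\<close>

definition curvature :: "(real \<Rightarrow> real^2) \<Rightarrow> real \<Rightarrow> real" where
  "curvature X u = det (vector [deriv1 X u, deriv2 X u] :: real^2^2) / norm (deriv1 X u) ^ 3"


section \<open>The affine curve shortening flow\<close>

text \<open>
  \<open>Z t u\<close> is a family of curves with \<open>t\<close> in \<open>[0, T)\<close>; its time derivative is
  one-sided at \<open>t = 0\<close>. The library's \<open>root 3\<close> is the odd real cube root.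
\<close>

definition acsf_solution_up_to_reparam :: "real \<Rightarrow> (real \<Rightarrow> real \<Rightarrow> real^2) \<Rightarrow> bool" where
  "acsf_solution_up_to_reparam T Z \<longleftrightarrow>
    (\<forall>t\<in>{0..<T}. plane_curve (Z t) \<and>
      (\<forall>u. \<exists>V. ((\<lambda>s. Z s u) has_vector_derivative V) (at t within {0..<T}) \<and>
            V \<bullet> unit_normal (Z t) u = root 3 (curvature (Z t) u)))"

definition affine_self_similar :: "(real \<Rightarrow> real^2) \<Rightarrow> bool" where
  "affine_self_similar X \<longleftrightarrow>
    plane_curve X \<and>
    (\<exists>(T::real) (A :: real \<Rightarrow> real^2^2) (H :: real \<Rightarrow> real^2).
      T > 0 \<and> smooth_on {0..<T} A \<and> smooth_on {0..<T} H \<and>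
      (\<forall>t\<in>{0..<T}. invertible (A t)) \<and> A 0 = mat 1 \<and> H 0 = 0 \<and>
      acsf_solution_up_to_reparam T (\<lambda>t u. A t *v X u + H t))"

text \<open>The equation \<open>\<langle>V(X), N\<^sub>X\<rangle> = k\<^sub>X\<^bsup>1/3\<^esup>\<close> for a vector field \<open>V\<close> on the plane.\<close>

definition soliton_eq :: "(real^2 \<Rightarrow> real^2) \<Rightarrow> (real \<Rightarrow> real^2) \<Rightarrow> bool" where
  "soliton_eq V X \<longleftrightarrow> (\<forall>u. V (X u) \<bullet> unit_normal X u = root 3 (curvature X u))"

end

theory Submission
  imports Defs
begin

text \<open>
  Write \<open>[a, b]\<close> for the oriented area spanned by two vectors (\<open>cross2\<close> below). Multiplied by the
  speed and cubed, the equation \<open>\<langle>V(X), N\<rangle> = k\<^bsup>1/3\<^esup>\<close> becomes \<open>[X', V(X)]\<^sup>3 = [X', X'']\<close>. A linear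
  map \<open>Q\<close> multiplies areas by \<open>det Q\<close>, so the image of a solution under \<open>Q\<close> solves the equation for
  the pushed-forward field times \<open>c\<close>, where \<open>c\<^sup>3 (det Q)\<^sup>2 = 1\<close> (\<open>soliton_eq_affine_image\<close>).
  Choosing \<open>Q\<close> and the translation amounts to choosing an affine frame: an origin \<open>h\<close> and a
  basis \<open>v, w\<close> with \<open>[v, w]\<^sup>2 = c\<^sup>3\<close> (\<open>affine_image_solves_frame\<close>).

  If \<open>C\<close> is in the range of \<open>B\<close>, the field has a zero, which is taken as the origin. Dilating the
  basis then realizes every \<open>c > 0\<close>, so the claim is the classification of real two by two matrices
  up to similarity and positive factors: eigenvectors, a Jordan basis, or a basis in which \<open>B\<close> acts
  as a complex number. If \<open>C\<close> is not in the range, the frame is built from \<open>C\<close> itself, and the one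
  scale that is still free is fixed by the area condition; the power \<open>c\<^sup>3\<close> leaves this
  solvable in each case.

  One situation is different. If the field is zero, the normal form \<open>(0, 1)\<close> does not come from a
  pushed-forward field; but then the curvature vanishes, the curve lies on a line, and this line can
  be made parallel to \<open>(0, 1)\<close> (\<open>affine_image_solves_line\<close>).

  The conditions of the cases depend only on \<open>C\<close> being in the range, on \<open>B\<close> being zero or
  diagonalizable, and on the signs of trace, determinant and discriminant; rewritten in this way they
  are seen to be disjoint and exhaustive.
\<close>

section \<open>The area form of the plane\<close>

definition cross2 :: "real^2 \<Rightarrow> real^2 \<Rightarrow> real" where
  "cross2 a b = a $ 1 * b $ 2 - a $ 2 * b $ 1"

lemmas coordinate_simps = vec_eq_iff forall_2 matrix_vector_mult_def sum_2 inner_vec_def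

lemma cross2_simps [simp]:
  "cross2 (a + b) c = cross2 a c + cross2 b c" "cross2 a (b + c) = cross2 a b + cross2 a c"
  "cross2 (r *\<^sub>R a) b = r * cross2 a b" "cross2 a (r *\<^sub>R b) = r * cross2 a b"
  "cross2 a a = 0" "cross2 a 0 = 0" "cross2 0 a = 0"
  by (simp_all add: cross2_def algebra_simps)

lemma cross2_eq_0_imp_parallel:
  assumes "cross2 a b = 0" "a \<noteq> 0"
  shows "\<exists>t. b = t *\<^sub>R a"
proof (cases "a $ 1 = 0")
  case True
  then have "a $ 2 \<noteq> 0" "b $ 1 = 0"
    using assms by (auto simp: cross2_def coordinate_simps)
  then show ?thesis using True by (intro exI[of _ "b $ 2 / a $ 2"]) (simp add: coordinate_simps)
next
  case False
  then show ?thesis using assms(1)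
    by (intro exI[of _ "b $ 1 / a $ 1"]) (simp add: coordinate_simps cross2_def field_simps)
qed

lemma cross2_matrix_vector: "cross2 (Q *v a) (Q *v b) = det Q * cross2 a b"
  by (simp add: cross2_def det_2 coordinate_simps algebra_simps)

lemma matrix_vector_mult_0_imp_0:
  fixes Q :: "real^2^2" assumes "det Q \<noteq> 0" "Q *v a = 0" shows "a = 0"
  using assms by (metis invertible_det_nz invertible_left_inverse matrix_left_invertible_ker)

section \<open>Affine images of solitons\<close>

lemma plane_curve_derivs:
  assumes "plane_curve X"
  shows "(X has_vector_derivative deriv1 X u) (at u)"
    and "(deriv1 X has_vector_derivative deriv2 X u) (at u)"
    and "deriv1 X u \<noteq> 0"
proof -
  obtain D where D: "D 0 = X"
    "\<And>n t. (D n has_vector_derivative D (Suc n) t) (at t)"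
    using assms unfolding plane_curve_def smooth_on_def by auto
  have 1: "deriv1 X = D (Suc 0)"
    using D vector_derivative_at unfolding deriv1_def by fastforce
  then have "deriv2 X = D (Suc (Suc 0))"
    using D(2) vector_derivative_at unfolding deriv2_def by fastforce
  with 1 D show "(X has_vector_derivative deriv1 X u) (at u)"
    "(deriv1 X has_vector_derivative deriv2 X u) (at u)"
    by metis+
  show "deriv1 X u \<noteq> 0" using assms unfolding plane_curve_def by blast
qed

lemma affine_image_derivs:
  fixes Q :: "real^2^2"
  assumes "plane_curve X"
  shows "deriv1 (\<lambda>u. Q *v X u + H) u = Q *v deriv1 X u"
    and "deriv2 (\<lambda>u. Q *v X u + H) u = Q *v deriv2 X u"
proof -
  note lin = bounded_linear.has_vector_derivative[OF matrix_vector_mul_bounded_linear[of Q]]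
  have 1: "deriv1 (\<lambda>u. Q *v X u + H) u = Q *v deriv1 X u" for u
    unfolding deriv1_def
    using lin[OF plane_curve_derivs(1)[OF assms]]
    by (intro vector_derivative_at)
       (auto simp: has_vector_derivative_add_const deriv1_def)
  then show "deriv1 (\<lambda>u. Q *v X u + H) u = Q *v deriv1 X u" .
  show "deriv2 (\<lambda>u. Q *v X u + H) u = Q *v deriv2 X u"
    unfolding deriv2_def 1
    using lin[OF plane_curve_derivs(2)[OF assms]]
    by (intro vector_derivative_at) (auto simp: deriv2_def)
qed

text \<open>
  Multiplying by the speed and cubing removes both the norm and the cube root. What is left is an
  identity between oriented areas, whose behaviour under affine maps is governed by the
  determinant alone; this is where the exponent \<open>1/3\<close> makes the flow affinely invariant.
\<close>

lemma normal_speed_eq_iff: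
  assumes "deriv1 X u \<noteq> 0"
  shows "V \<bullet> unit_normal X u = root 3 (curvature X u) \<longleftrightarrow>
    cross2 (deriv1 X u) V ^ 3 = cross2 (deriv1 X u) (deriv2 X u)"
proof -
  define n where "n = norm (deriv1 X u)"
  have n: "n > 0" using assms n_def by simp
  have 1: "V \<bullet> unit_normal X u = cross2 (deriv1 X u) V / n"
    unfolding unit_normal_def unit_tangent_def rotJ_def n_def[symmetric]
    using n by (simp add: cross2_def coordinate_simps field_simps)
  have 2: "root 3 (curvature X u) = root 3 (cross2 (deriv1 X u) (deriv2 X u)) / n"
    unfolding curvature_def n_def[symmetric]
    using n by (simp add: real_root_divide real_root_power_cancel det_2 cross2_def odd_real_root_power_cancel)
  have "cross2 (deriv1 X u) V = root 3 (cross2 (deriv1 X u) (deriv2 X u)) \<longleftrightarrow>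
    cross2 (deriv1 X u) V ^ 3 = cross2 (deriv1 X u) (deriv2 X u)"
    by (metis odd_real_root_pow odd_real_root_power_cancel odd_numeral)
  then show ?thesis using 1 2 n by simp
qed

text \<open>
  In the area form of the equation, applying \<open>Q\<close> multiplies the left side by
  \<open>c\<^sup>3 (det Q)\<^sup>3\<close> and the right side by \<open>det Q\<close>. So the pushed-forward field solves the equation
  as soon as it is rescaled by the \<open>c\<close> that compensates the two factors. In particular
  \<open>c\<close> is positive, which is why the signs of the eigenvalues survive normalization, while the
  orientation of \<open>Q\<close> is free.
\<close>

lemma soliton_eq_affine_image:
  fixes Q :: "real^2^2"
  assumes X: "plane_curve X" "soliton_eq V X"
    and c: "c ^ 3 * (det Q)\<^sup>2 = 1"
    and W: "\<And>x. W (Q *v x + H) = c *\<^sub>R (Q *v V x)"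
  shows "soliton_eq W (\<lambda>u. Q *v X u + H)"
  unfolding soliton_eq_def
proof
  fix u
  let ?Y = "\<lambda>u. Q *v X u + H"
  have dQ: "det Q \<noteq> 0" using c by auto
  have nz: "deriv1 ?Y u \<noteq> 0"
    unfolding affine_image_derivs[OF X(1)]
    using matrix_vector_mult_0_imp_0[OF dQ] plane_curve_derivs(3)[OF X(1)] by blast
  have "cross2 (deriv1 X u) (V (X u)) ^ 3 = cross2 (deriv1 X u) (deriv2 X u)"
    using X(2) normal_speed_eq_iff[OF plane_curve_derivs(3)[OF X(1)]]
    unfolding soliton_eq_def by blast
  moreover have "(c * (det Q * cross2 (deriv1 X u) (V (X u)))) ^ 3
      = (c ^ 3 * (det Q)\<^sup>2) * (det Q * cross2 (deriv1 X u) (V (X u)) ^ 3)"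
    by (simp add: power2_eq_square power3_eq_cube)
  ultimately have "cross2 (deriv1 ?Y u) (W (?Y u)) ^ 3 = cross2 (deriv1 ?Y u) (deriv2 ?Y u)"
    unfolding affine_image_derivs[OF X(1)] W
    by (simp add: cross2_matrix_vector c)
  then show "W (?Y u) \<bullet> unit_normal ?Y u = root 3 (curvature ?Y u)"
    using normal_speed_eq_iff[OF nz] by blast
qed

definition affine_image_solves :: "(real \<Rightarrow> real^2) \<Rightarrow> (real^2 \<Rightarrow> real^2) \<Rightarrow> bool" where
  "affine_image_solves X W \<longleftrightarrow>
    (\<exists>(Q::real^2^2) H. invertible Q \<and> soliton_eq W (\<lambda>u. Q *v X u + H))"

text \<open>
  Reads the equation in the affine coordinates with origin \<open>h\<close> and basis \<open>v, w\<close>: the hypotheses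
  express \<open>c\<close> times the field \<open>B x + C\<close> in this frame. The coordinate map has determinant
  \<open>1 / cross2 v w\<close>, so the scaling condition on \<open>c\<close> becomes the condition on the area of the frame.
  Every normal form of a nonzero field comes from a suitable frame.
\<close>

lemma affine_image_solves_frame:
  fixes B :: "real^2^2"
  assumes X: "plane_curve X" "soliton_eq (\<lambda>x. B *v x + C) X"
    and area: "(cross2 v w)\<^sup>2 = c ^ 3" "cross2 v w \<noteq> 0"
    and Bv: "c *\<^sub>R (B *v v) = n11 *\<^sub>R v + n21 *\<^sub>R w"
    and Bw: "c *\<^sub>R (B *v w) = n12 *\<^sub>R v + n22 *\<^sub>R w"
    and Bh: "c *\<^sub>R (B *v h + C) = e1 *\<^sub>R v + e2 *\<^sub>R w"
  shows "affine_image_solves X (\<lambda>y. mat22 n11 n12 n21 n22 *v y + vec2 e1 e2)"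
proof -
  define d where "d = cross2 v w"
  \<comment> \<open>The inverse of the matrix with columns \<open>v\<close> and \<open>w\<close>, by Cramer's rule.\<close>
  define Q where "Q = mat22 (w $ 2 / d) (- w $ 1 / d) (- v $ 2 / d) (v $ 1 / d)"
  have d: "d \<noteq> 0" using area d_def by simp
  have Qx: "Q *v x = vec2 (cross2 x w / d) (cross2 v x / d)" for x
    using d by (simp add: Q_def cross2_def coordinate_simps field_simps)
  have QvQw: "Q *v v = vec2 1 0" "Q *v w = vec2 0 1"
    using d by (simp_all add: Qx d_def)
  have detQ: "det Q = 1 / d"
    using d by (simp add: Q_def det_2 divide_simps) (simp add: d_def cross2_def)
  have cramer: "x - h = (cross2 (x - h) w / d) *\<^sub>R v + (cross2 v (x - h) / d) *\<^sub>R w" for x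
    using d by (simp add: coordinate_simps divide_simps) (simp add: d_def cross2_def algebra_simps)
  have W: "mat22 n11 n12 n21 n22 *v (Q *v x + - (Q *v h)) + vec2 e1 e2 = c *\<^sub>R (Q *v (B *v x + C))"
    for x
  proof -
    define p q where "p = cross2 (x - h) w / d" and "q = cross2 v (x - h) / d"
    have "x = h + (p *\<^sub>R v + q *\<^sub>R w)"
      using cramer[of x] p_def q_def by (metis add.commute diff_add_cancel)
    then have "c *\<^sub>R (B *v x + C) = c *\<^sub>R (B *v h + C) + p *\<^sub>R (c *\<^sub>R (B *v v)) + q *\<^sub>R (c *\<^sub>R (B *v w))"
      by (simp add: matrix_vector_right_distrib matrix_vector_mult_scaleR algebra_simps)
    also have "\<dots> = (e1 + n11 * p + n12 * q) *\<^sub>R v + (e2 + n21 * p + n22 * q) *\<^sub>R w"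
      unfolding Bv Bw Bh by (simp add: algebra_simps)
    finally have "Q *v (c *\<^sub>R (B *v x + C))
        = (e1 + n11 * p + n12 * q) *\<^sub>R (Q *v v) + (e2 + n21 * p + n22 * q) *\<^sub>R (Q *v w)"
      by (simp only: matrix_vector_right_distrib matrix_vector_mult_scaleR)
    then have "c *\<^sub>R (Q *v (B *v x + C)) = vec2 (e1 + n11 * p + n12 * q) (e2 + n21 * p + n22 * q)"
      unfolding QvQw matrix_vector_mult_scaleR by (simp add: coordinate_simps)
    moreover have "Q *v x + - (Q *v h) = vec2 p q"
      by (simp add: matrix_vector_mult_diff_distrib[symmetric]) (simp add: Qx p_def q_def)
    ultimately show ?thesis by (simp add: coordinate_simps)
  qed
  have "c \<noteq> 0" using area by auto
  then have "soliton_eq (\<lambda>y. mat22 n11 n12 n21 n22 *v y + vec2 e1 e2) (\<lambda>u. Q *v X u + - (Q *v h))"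
    using area d by (intro soliton_eq_affine_image[OF X _ W])
      (simp add: detQ power_divide d_def)
  moreover have "invertible Q" using detQ d by (simp add: invertible_det_nz)
  ultimately show ?thesis unfolding affine_image_solves_def by blast
qed

text \<open>
  If \<open>C\<close> lies in the range of \<open>B\<close>, translating the origin removes it, and the remaining linear
  conditions are homogeneous in the frame. The area condition can then be met by a common dilation
  of \<open>v\<close> and \<open>w\<close>, so that every \<open>c > 0\<close> is available: \<open>B\<close> matters only up to similarity and a
  positive factor.
\<close>

lemma affine_image_solves_linear_frame:
  fixes B :: "real^2^2"
  assumes X: "plane_curve X" "soliton_eq (\<lambda>x. B *v x + C) X"
    and C: "C \<in> range (\<lambda>x. B *v x)"
    and indep: "cross2 v w \<noteq> 0" and c: "c > 0"
    and Bv: "c *\<^sub>R (B *v v) = n11 *\<^sub>R v + n21 *\<^sub>R w"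
    and Bw: "c *\<^sub>R (B *v w) = n12 *\<^sub>R v + n22 *\<^sub>R w"
  shows "affine_image_solves X (\<lambda>y. mat22 n11 n12 n21 n22 *v y)"
proof -
  \<comment> \<open>Dilating by \<open>s\<close> multiplies the squared area by \<open>s\<^sup>4\<close>.\<close>
  define s where "s = sqrt (sqrt (c ^ 3) / \<bar>cross2 v w\<bar>)"
  have s2: "s\<^sup>2 = sqrt (c ^ 3) / \<bar>cross2 v w\<bar>" "s \<noteq> 0"
    using c indep by (simp_all add: s_def)
  obtain x where x: "C = B *v x" using C by blast
  have h: "c *\<^sub>R (B *v (- x) + C) = 0 *\<^sub>R v + 0 *\<^sub>R w"
    by (simp add: x coordinate_simps)
  have "(s\<^sup>2 * cross2 v w)\<^sup>2 = c ^ 3"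
    unfolding s2 using c indep by (simp add: power_mult_distrib power_divide)
  then have "(cross2 (s *\<^sub>R v) (s *\<^sub>R w))\<^sup>2 = c ^ 3" "cross2 (s *\<^sub>R v) (s *\<^sub>R w) \<noteq> 0"
    using s2 indep by (simp_all add: power2_eq_square mult.assoc)
  moreover have "c *\<^sub>R (B *v (s *\<^sub>R v)) = n11 *\<^sub>R (s *\<^sub>R v) + n21 *\<^sub>R (s *\<^sub>R w)"
    "c *\<^sub>R (B *v (s *\<^sub>R w)) = n12 *\<^sub>R (s *\<^sub>R v) + n22 *\<^sub>R (s *\<^sub>R w)"
    using arg_cong[OF Bv, of "\<lambda>x. s *\<^sub>R x"] arg_cong[OF Bw, of "\<lambda>x. s *\<^sub>R x"]
    by (simp_all add: matrix_vector_mult_scaleR algebra_simps)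
  moreover have "c *\<^sub>R (B *v (- x) + C) = 0 *\<^sub>R (s *\<^sub>R v) + 0 *\<^sub>R (s *\<^sub>R w)"
    using h by simp
  ultimately have "affine_image_solves X (\<lambda>y. mat22 n11 n12 n21 n22 *v y + vec2 0 0)"
    by (intro affine_image_solves_frame[OF X])
  moreover have "vec2 0 0 = (0::real^2)" by (simp add: coordinate_simps)
  ultimately show ?thesis by simp
qed

section \<open>Trace and determinant determine the case\<close>

text \<open>
  The Cayley-Hamilton theorem for two by two matrices.
\<close>

lemma mat2_quadratic:
  fixes B :: "real^2^2"
  shows "B *v (B *v x) = trace B *\<^sub>R (B *v x) - det B *\<^sub>R x"
  by (simp add: coordinate_simps trace_def det_2 algebra_simps)

lemma eigenvalue_iff_root:
  fixes B :: "real^2^2"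
  shows "eigenvalue B l \<longleftrightarrow> l\<^sup>2 - trace B * l + det B = 0"
proof -
  have "eigenvalue B l \<longleftrightarrow> (\<exists>v. v \<noteq> 0 \<and> (B - l *\<^sub>R mat 1) *v v = 0)"
    by (simp add: eigenvalue_def matrix_vector_mult_diff_rdistrib scaleR_matrix_vector_assoc[symmetric])
  also have "\<dots> \<longleftrightarrow> det (B - l *\<^sub>R mat 1) = 0"
    by (metis invertible_det_nz invertible_left_inverse matrix_left_invertible_ker)
  also have "det (B - l *\<^sub>R mat 1) = l\<^sup>2 - trace B * l + det B"
    by (simp add: det_2 trace_def sum_2 mat_def algebra_simps power2_eq_square)
  finally show ?thesis .
qed

lemma charpoly_2:
  fixes B :: "real^2^2"
  shows "charpoly B = [:det B, - trace B, 1:]"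
  by (simp add: charpoly_def det_2 trace_def sum_2 algebra_simps)

lemma double_eigenvalue_iff:
  fixes B :: "real^2^2"
  shows "double_eigenvalue B l \<longleftrightarrow> trace B = 2 * l \<and> det B = l\<^sup>2"
proof -
  have sq: "[:-l, 1:] ^ 2 = [:l\<^sup>2, - (2 * l), 1:]"
    by (simp add: power2_eq_square)
  show ?thesis
  proof
    assume "double_eigenvalue B l"
    then have "[:-l, 1:] ^ 2 dvd charpoly B"
      using order_1[of l "charpoly B"] by (simp add: double_eigenvalue_def)
    then obtain q where q: "charpoly B = [:-l, 1:] ^ 2 * q" by blast
    then have "q \<noteq> 0" by (auto simp: charpoly_2)
    then have "degree (charpoly B) = 2 + degree q"
      by (simp add: q degree_mult_eq degree_power_eq)
    then have "degree q = 0" by (simp add: charpoly_2)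
    then obtain r where "q = [:r:]" by (metis degree_0_id degree_eq_zeroE)
    then show "trace B = 2 * l \<and> det B = l\<^sup>2"
      using q unfolding sq charpoly_2 by auto
  next
    assume "trace B = 2 * l \<and> det B = l\<^sup>2"
    then have "charpoly B = [:-l, 1:] ^ 2" unfolding sq charpoly_2 by simp
    then show "double_eigenvalue B l"
      unfolding double_eigenvalue_def by (simp only: order_power_n_n)
  qed
qed

lemma matrix_inv_mult:
  fixes A :: "real^'n^'m"
  assumes "invertible A"
  shows "A ** matrix_inv A = mat 1" "matrix_inv A ** A = mat 1"
  using someI_ex[OF assms[unfolded invertible_def]] unfolding matrix_inv_def by blast+

text \<open>
  A double root forces both diagonal entries of a diagonal form to agree, and a scalar matrix is
  unchanged by conjugation.
\<close>

lemma diagonalizable_double_root_iff: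
  fixes B :: "real^2^2"
  assumes "(trace B)\<^sup>2 = 4 * det B"
  shows "diagonalizable B \<longleftrightarrow> B = (trace B / 2) *\<^sub>R mat 1"
proof
  assume "diagonalizable B"
  then obtain P D :: "real^2^2" where P: "invertible P"
    and D: "\<forall>i j. i \<noteq> j \<longrightarrow> D $ i $ j = 0" and B: "B = P ** D ** matrix_inv P"
    unfolding diagonalizable_def by blast
  have inv: "P ** matrix_inv P = mat 1" "matrix_inv P ** P = mat 1"
    using matrix_inv_mult[OF P] by simp_all
  have "trace B = trace D"
    unfolding B using inv by (metis trace_mul_sym matrix_mul_assoc matrix_mul_lid)
  moreover have "det B = det D"
  proof -
    have "det P * det (matrix_inv P) = 1" using inv(1) by (metis det_I det_mul)
    then show ?thesis unfolding B det_mul by (simp add: algebra_simps)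
  qed
  moreover have off: "D $ 1 $ 2 = 0" "D $ 2 $ 1 = 0" using D by auto
  ultimately have t: "trace B = D $ 1 $ 1 + D $ 2 $ 2" "det B = D $ 1 $ 1 * D $ 2 $ 2"
    by (simp_all add: trace_def sum_2 det_2)
  have "(D $ 1 $ 1 - D $ 2 $ 2)\<^sup>2 = 0"
    using assms unfolding t by (simp add: power2_eq_square algebra_simps)
  then have eq: "D $ 2 $ 2 = D $ 1 $ 1" by simp
  then have "D = (D $ 1 $ 1) *\<^sub>R mat 1" using off
    by (simp add: coordinate_simps mat_def)
  then have "B = (D $ 1 $ 1) *\<^sub>R mat 1"
    unfolding B by (metis inv(1) matrix_mul_rid matrix_scalar_ac scalar_matrix_assoc scalar_mult_eq_scaleR)
  then show "B = (trace B / 2) *\<^sub>R mat 1"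
    unfolding t eq by simp
next
  assume B: "B = (trace B / 2) *\<^sub>R mat 1"
  have I: "invertible (mat 1 :: real^2^2)" by (simp add: invertible_det_nz)
  then have "matrix_inv (mat 1 :: real^2^2) = mat 1"
    using matrix_inv_mult(1) by fastforce
  then have "B = mat 1 ** B ** matrix_inv (mat 1)" by simp
  moreover note I
  moreover have "\<forall>i j. i \<noteq> j \<longrightarrow> B $ i $ j = 0" by (subst B) (simp add: mat_def)
  ultimately show "diagonalizable B" unfolding diagonalizable_def by blast
qed

text \<open>
  This and the next lemmas on signs turn the conditions of the classification into conditions on the trace
  alone. This makes it evident that the cases exclude each other and that none is missing.
\<close>

lemma ex_eigenvalue_sign_singular:
  fixes B :: "real^2^2"
  assumes "det B = 0"
  shows "(\<exists>l>0. eigenvalue B l) \<longleftrightarrow> trace B > 0"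
    and "(\<exists>l<0. eigenvalue B l) \<longleftrightarrow> trace B < 0"
proof -
  have "eigenvalue B l \<longleftrightarrow> l = 0 \<or> l = trace B" for l
    by (auto simp: eigenvalue_iff_root assms power2_eq_square)
  then show "(\<exists>l>0. eigenvalue B l) \<longleftrightarrow> trace B > 0" "(\<exists>l<0. eigenvalue B l) \<longleftrightarrow> trace B < 0"
    by auto
qed

lemma ex_double_eigenvalue_sign:
  fixes B :: "real^2^2"
  assumes "(trace B)\<^sup>2 - 4 * det B = 0"
  shows "(\<exists>l>0. double_eigenvalue B l) \<longleftrightarrow> trace B > 0"
    and "(\<exists>l<0. double_eigenvalue B l) \<longleftrightarrow> trace B < 0"
proof -
  have "det B = (trace B / 2)\<^sup>2" using assms by (simp add: power_divide)
  then have "double_eigenvalue B (trace B / 2)" by (simp add: double_eigenvalue_iff)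
  moreover have "trace B = 2 * l" if "double_eigenvalue B l" for l
    using that by (simp add: double_eigenvalue_iff)
  moreover have "trace B > 0 \<longleftrightarrow> trace B / 2 > 0" "trace B < 0 \<longleftrightarrow> trace B / 2 < 0" by simp_all
  ultimately show "(\<exists>l>0. double_eigenvalue B l) \<longleftrightarrow> trace B > 0"
    "(\<exists>l<0. double_eigenvalue B l) \<longleftrightarrow> trace B < 0"
    by (metis mult_pos_pos mult_pos_neg zero_less_numeral)+
qed

lemma distinct_eigenvalues:
  fixes B :: "real^2^2"
  assumes "(trace B)\<^sup>2 - 4 * det B > 0"
  obtains l m where "l < m" "l + m = trace B" "l * m = det B"
    "\<And>x. eigenvalue B x \<longleftrightarrow> x = l \<or> x = m"
proof -
  define r where "r = sqrt ((trace B)\<^sup>2 - 4 * det B)"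
  define l m where "l = (trace B - r) / 2" and "m = (trace B + r) / 2"
  have r: "r > 0" "r * r = trace B * trace B - 4 * det B"
    using assms by (simp_all add: r_def power2_eq_square)
  have lm: "l < m" "l + m = trace B" "l * m = det B"
    using r by (simp_all add: l_def m_def field_simps)
  moreover have "eigenvalue B x \<longleftrightarrow> x = l \<or> x = m" for x
  proof -
    have "eigenvalue B x \<longleftrightarrow> (x - l) * (x - m) = 0"
      unfolding eigenvalue_iff_root lm(2,3)[symmetric]
      by (simp add: power2_eq_square algebra_simps)
    then show ?thesis by simp
  qed
  ultimately show ?thesis using that by blast
qed

lemma ex_two_eigenvalues_sign:
  fixes B :: "real^2^2"
  assumes "(trace B)\<^sup>2 - 4 * det B > 0" "det B > 0"
  shows "(\<exists>l m. l \<noteq> m \<and> l > 0 \<and> m > 0 \<and> eigenvalue B l \<and> eigenvalue B m) \<longleftrightarrow> trace B > 0"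
    and "(\<exists>l m. l \<noteq> m \<and> l < 0 \<and> m < 0 \<and> eigenvalue B l \<and> eigenvalue B m) \<longleftrightarrow> trace B < 0"
proof -
  obtain l m where lm: "l < m" "l + m = trace B" "l * m = det B"
    "\<And>x. eigenvalue B x \<longleftrightarrow> x = l \<or> x = m"
    using distinct_eigenvalues[OF assms(1)] by blast
  have "(l > 0 \<and> m > 0) \<or> (l < 0 \<and> m < 0)"
    using assms(2) unfolding lm(3)[symmetric] by (auto simp: zero_less_mult_iff)
  then show "(\<exists>l m. l \<noteq> m \<and> l > 0 \<and> m > 0 \<and> eigenvalue B l \<and> eigenvalue B m) \<longleftrightarrow> trace B > 0"
    "(\<exists>l m. l \<noteq> m \<and> l < 0 \<and> m < 0 \<and> eigenvalue B l \<and> eigenvalue B m) \<longleftrightarrow> trace B < 0"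
    unfolding lm(2)[symmetric] lm(4) using lm(1) by (auto intro: exI[of _ l])
qed

lemma range_nonsingular:
  fixes B :: "real^2^2"
  assumes "det B \<noteq> 0" shows "C \<in> range (\<lambda>x. B *v x)"
proof -
  have "C = B *v (matrix_inv B *v C)"
    using assms by (simp add: matrix_vector_mul_assoc matrix_inv_mult invertible_det_nz)
  then show ?thesis by blast
qed

section \<open>Fields with a fixed point\<close>

lemma eigenvectors_frame:
  fixes B :: "real^2^2"
  assumes "eigenvalue B l" "eigenvalue B m" "l \<noteq> m"
  obtains v w where "cross2 v w \<noteq> 0" "B *v v = l *\<^sub>R v" "B *v w = m *\<^sub>R w"
proof -
  obtain v w where v: "v \<noteq> 0" "B *v v = l *\<^sub>R v" and w: "w \<noteq> 0" "B *v w = m *\<^sub>R w"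
    using assms by (auto simp: eigenvalue_def)
  have "cross2 v w \<noteq> 0"
  proof
    assume "cross2 v w = 0"
    then obtain t where t: "w = t *\<^sub>R v" using cross2_eq_0_imp_parallel v by blast
    then have "l *\<^sub>R w = m *\<^sub>R w"
      using v w(2) by (simp add: matrix_vector_mult_scaleR)
    then show False using w assms(3) by simp
  qed
  then show ?thesis using that v w by blast
qed

lemma affine_image_solves_diagonal:
  fixes B :: "real^2^2"
  assumes X: "plane_curve X" "soliton_eq (\<lambda>x. B *v x + C) X" "C \<in> range (\<lambda>x. B *v x)"
    and "eigenvalue B l" "eigenvalue B m" "l \<noteq> m" and c: "c > 0"
  shows "affine_image_solves X (\<lambda>y. mat22 (c * l) 0 0 (c * m) *v y)"
proof -
  obtain v w where "cross2 v w \<noteq> 0" "B *v v = l *\<^sub>R v" "B *v w = m *\<^sub>R w"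
    using eigenvectors_frame assms by blast
  then show ?thesis by (intro affine_image_solves_linear_frame[OF X _ c]) auto
qed

lemma affine_image_solves_scalar:
  fixes B :: "real^2^2"
  assumes X: "plane_curve X" "soliton_eq (\<lambda>x. B *v x + C) X" "C \<in> range (\<lambda>x. B *v x)"
    and B: "B = l *\<^sub>R mat 1" and c: "c > 0"
  shows "affine_image_solves X (\<lambda>y. mat22 (c * l) 0 0 (c * l) *v y)"
  by (rule affine_image_solves_linear_frame[OF X _ c, of "vec2 1 0" "vec2 0 1"])
     (simp_all add: B cross2_def coordinate_simps mat_def)

text \<open>
  With a double root \<open>l\<close>, the matrix \<open>B - l\<close> squares to zero, so its values are eigenvectors
  or zero.
\<close>

lemma double_root_nilpotent:
  fixes B :: "real^2^2"
  assumes "(trace B)\<^sup>2 - 4 * det B = 0" and l: "l = trace B / 2"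
  shows "B *v (B *v x - l *\<^sub>R x) = l *\<^sub>R (B *v x - l *\<^sub>R x)"
proof -
  have tr: "trace B = 2 * l" using l by simp
  moreover have "det B = l * l" using assms(1) unfolding tr by (simp add: power2_eq_square)
  ultimately show ?thesis
    by (simp add: matrix_vector_mult_diff_distrib mat2_quadratic matrix_vector_mult_scaleR scaleR_diff_right)
       (simp add: algebra_simps coordinate_simps)
qed

text \<open>
  A vector outside the eigenspace, and its image under \<open>B - l\<close>, form a Jordan basis. The extra
  factor \<open>c\<close> in the first basis vector makes the off-diagonal entry equal to \<open>1\<close> after the
  rescaling.
\<close>

lemma affine_image_solves_Jordan:
  fixes B :: "real^2^2"
  assumes X: "plane_curve X" "soliton_eq (\<lambda>x. B *v x + C) X" "C \<in> range (\<lambda>x. B *v x)"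
    and disc: "(trace B)\<^sup>2 - 4 * det B = 0" and l: "l = trace B / 2"
    and B: "B \<noteq> l *\<^sub>R mat 1" and c: "c > 0"
  shows "affine_image_solves X (\<lambda>y. mat22 (c * l) 1 0 (c * l) *v y)"
proof -
  obtain w where w: "B *v w \<noteq> l *\<^sub>R w"
    using B matrix_eq[of B "l *\<^sub>R mat 1"] by (auto simp: scaleR_matrix_vector_assoc[symmetric])
  define v where "v = c *\<^sub>R (B *v w - l *\<^sub>R w)"
  have v: "B *v v = l *\<^sub>R v"
    using double_root_nilpotent[OF disc l] by (simp add: v_def matrix_vector_mult_scaleR)
  have "v \<noteq> 0" using w c by (simp add: v_def)
  have "cross2 v w \<noteq> 0"
  proof
    assume "cross2 v w = 0"
    then obtain t where "w = t *\<^sub>R v" using cross2_eq_0_imp_parallel \<open>v \<noteq> 0\<close> by blast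
    then show False using w v by (simp add: matrix_vector_mult_scaleR)
  qed
  moreover have "c *\<^sub>R (B *v w) = 1 *\<^sub>R v + (c * l) *\<^sub>R w"
    by (simp add: v_def algebra_simps)
  ultimately show ?thesis using v
    by (intro affine_image_solves_linear_frame[OF X _ c]) auto
qed

text \<open>
  Without real eigenvalues, \<open>B - p\<close> squares to \<open>-b\<^sup>2\<close>, where \<open>p\<close> is half the trace. Any nonzero
  vector together with its image under \<open>(B - p) / b\<close> is then a basis in which \<open>B\<close> acts as
  \<open>p + b J\<close>. The scale \<open>c\<close> stays free, to normalize \<open>p\<close> or \<open>b\<close> later.
\<close>

lemma affine_image_solves_complex:
  fixes B :: "real^2^2"
  assumes X: "plane_curve X" "soliton_eq (\<lambda>x. B *v x + C) X" "C \<in> range (\<lambda>x. B *v x)"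
    and disc: "(trace B)\<^sup>2 - 4 * det B < 0"
  shows "\<exists>b>0. \<forall>c>0. affine_image_solves X
    (\<lambda>y. mat22 (c * (trace B / 2)) (- (c * b)) (c * b) (c * (trace B / 2)) *v y)"
proof -
  define p where "p = trace B / 2"
  define b where "b = sqrt (4 * det B - (trace B)\<^sup>2) / 2"
  have b: "b > 0" "b * b = det B - p * p"
    using disc by (simp_all add: b_def p_def power2_eq_square)
  define v :: "real^2" where "v = vec2 1 0"
  define w where "w = (1 / b) *\<^sub>R (B *v v - p *\<^sub>R v)"
  have v: "v \<noteq> 0" by (simp add: v_def coordinate_simps)
  have Bv: "B *v v = p *\<^sub>R v + b *\<^sub>R w" using b by (simp add: w_def)
  have "b *\<^sub>R (B *v w) = B *v (B *v v) - p *\<^sub>R (B *v v)"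
    using b by (simp add: w_def matrix_vector_mult_scaleR matrix_vector_mult_diff_distrib)
  also have "\<dots> = p *\<^sub>R (B *v v) - (p * p + b * b) *\<^sub>R v"
    unfolding mat2_quadratic b by (simp add: p_def coordinate_simps algebra_simps)
  also have "\<dots> = b *\<^sub>R (p *\<^sub>R w - b *\<^sub>R v)"
    unfolding Bv by (simp add: algebra_simps)
  finally have Bw: "B *v w = p *\<^sub>R w - b *\<^sub>R v" using b by (metis less_irrefl real_vector.scale_left_imp_eq)
  have indep: "cross2 v w \<noteq> 0"
  proof
    assume "cross2 v w = 0"
    then obtain t where t: "w = t *\<^sub>R v" using cross2_eq_0_imp_parallel v by blast
    have "(p * t - b) *\<^sub>R v = (t * p + t * b * t) *\<^sub>R v"
      using Bw Bv unfolding t by (simp add: matrix_vector_mult_scaleR algebra_simps)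
    then have "p * t - b = t * p + t * b * t" using v by simp
    then have "b * (1 + t * t) = 0" by (simp add: algebra_simps)
    then show False using b by (smt (verit) mult_eq_0_iff zero_le_square)
  qed
  have "affine_image_solves X (\<lambda>y. mat22 (c * p) (- (c * b)) (c * b) (c * p) *v y)" if "c > 0" for c
    using indep that unfolding v_def[symmetric]
    by (intro affine_image_solves_linear_frame[OF X, of v w c])
       (simp_all add: Bv Bw scaleR_add_right scaleR_diff_right)
  then show ?thesis using b(1) unfolding p_def by blast
qed

section \<open>Fields without a fixed point\<close>

text \<open>
  Here \<open>B\<^sup>2 = l B\<close> with \<open>l\<close> the trace, so the plane is the sum of kernel and range. Moving the
  origin removes the part of \<open>C\<close> in the range, and \<open>c\<close> times the part in the kernel is the first basis
  vector. The length of the second basis vector, an eigenvector for \<open>l\<close>, remains free and is used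
  to adjust the area of the frame.
\<close>

lemma affine_image_solves_degenerate_translation:
  fixes B :: "real^2^2"
  assumes X: "plane_curve X" "soliton_eq (\<lambda>x. B *v x + C) X" "C \<notin> range (\<lambda>x. B *v x)"
    and "det B = 0" "trace B \<noteq> 0"
  shows "affine_image_solves X (\<lambda>y. mat22 0 0 0 (sgn (trace B)) *v y + vec2 1 0)"
proof -
  define l where "l = trace B"
  define c where "c = 1 / \<bar>l\<bar>"
  \<comment> \<open>This makes \<open>B h + C\<close> the projection of \<open>C\<close> to the kernel along the range.\<close>
  define h where "h = - (1 / l) *\<^sub>R C"
  have l: "l \<noteq> 0" and c: "c > 0" "c * l = sgn l"
    using assms by (simp_all add: l_def c_def sgn_if)
  define v where "v = c *\<^sub>R (B *v h + C)"
  have BB: "B *v (B *v x) = l *\<^sub>R (B *v x)" for x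
    using assms by (simp add: mat2_quadratic l_def)
  have v: "v \<noteq> 0" "B *v v = 0"
  proof -
    have "B *v h + C \<noteq> 0"
    proof
      assume "B *v h + C = 0"
      then have "C = B *v (- h)" by (simp add: coordinate_simps algebra_simps)
      then show False using X(3) by blast
    qed
    then show "v \<noteq> 0" using c by (simp add: v_def)
    show "B *v v = 0"
    proof -
      have Bh: "B *v h = (- (1 / l)) *\<^sub>R (B *v C)"
        by (simp only: h_def matrix_vector_mult_scaleR)
      have "B *v (B *v h) = - (B *v C)"
        unfolding BB unfolding Bh using l by simp
      then show ?thesis
        by (simp add: v_def matrix_vector_mult_scaleR matrix_vector_right_distrib)
    qed
  qed
  have "eigenvalue B l" by (simp add: eigenvalue_iff_root l_def power2_eq_square assms)
  then obtain w where w: "w \<noteq> 0" "B *v w = l *\<^sub>R w" unfolding eigenvalue_def by blast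
  have indep: "cross2 v w \<noteq> 0"
  proof
    assume "cross2 v w = 0"
    then obtain t where "w = t *\<^sub>R v" using cross2_eq_0_imp_parallel v by blast
    then show False using w v l by (simp add: matrix_vector_mult_scaleR)
  qed
  define b where "b = sqrt (c ^ 3) / cross2 v w"
  have b: "(cross2 v (b *\<^sub>R w))\<^sup>2 = c ^ 3" "cross2 v (b *\<^sub>R w) \<noteq> 0"
    using c indep by (simp_all add: b_def)
  have "affine_image_solves X (\<lambda>y. mat22 0 0 0 (sgn l) *v y + vec2 1 0)"
    using b v w c
    by (intro affine_image_solves_frame[OF X(1,2), of v "b *\<^sub>R w" c _ _ _ _ h])
       (simp_all add: v_def matrix_vector_mult_scaleR mult_ac)
  then show ?thesis by (simp add: l_def)
qed

text \<open>
  As \<open>C\<close> lies outside the range of \<open>B\<close>, which is also its kernel, \<open>C\<close> and \<open>B C\<close> are a basis.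
  With the origin kept, the normal form forces \<open>v = c\<^sup>2 B C\<close>, \<open>w = c C\<close>, of area \<open>c\<^sup>3 k\<close> with
  \<open>k = cross2 (B C) C\<close>; the area condition becomes \<open>c\<^sup>6 k\<^sup>2 = c\<^sup>3\<close> and determines \<open>c\<close>.
\<close>

lemma affine_image_solves_nilpotent_translation:
  fixes B :: "real^2^2"
  assumes X: "plane_curve X" "soliton_eq (\<lambda>x. B *v x + C) X" "C \<notin> range (\<lambda>x. B *v x)"
    and "det B = 0" "trace B = 0" "B \<noteq> 0"
  shows "affine_image_solves X (\<lambda>y. mat22 0 1 0 0 *v y + vec2 0 1)"
proof -
  have BB: "B *v (B *v x) = 0" for x
    using assms by (simp add: mat2_quadratic)
  define k where "k = cross2 (B *v C) C"
  have k: "k \<noteq> 0"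
  proof
    assume k0: "k = 0"
    have "0 \<in> range (\<lambda>x. B *v x)" by (rule range_eqI[of _ _ 0]) simp
    then have "C \<noteq> 0" using X(3) by metis
    have "cross2 C (B *v C) = 0" using k0 by (simp add: k_def cross2_def mult.commute)
    then obtain t where t: "B *v C = t *\<^sub>R C" using cross2_eq_0_imp_parallel \<open>C \<noteq> 0\<close> by blast
    then have "(t * t) *\<^sub>R C = 0" using BB[of C] by (simp add: matrix_vector_mult_scaleR)
    then have BC: "B *v C = 0" using t \<open>C \<noteq> 0\<close> by simp
    \<comment> \<open>Any vector is in the span of \<open>C\<close> and \<open>B x\<close>, both of which \<open>B\<close> kills, although \<open>B x \<noteq> 0\<close>.\<close>
    obtain x where x: "B *v x \<noteq> 0" using \<open>B \<noteq> 0\<close> matrix_eq[of B 0] by auto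
    have "cross2 (B *v x) C \<noteq> 0"
    proof
      assume "cross2 (B *v x) C = 0"
      then obtain s where "C = s *\<^sub>R (B *v x)" using cross2_eq_0_imp_parallel x by blast
      then have "C = B *v (s *\<^sub>R x)" by (simp add: matrix_vector_mult_scaleR)
      then show False using X(3) by blast
    qed
    \<comment> \<open>\<open>B\<close> applied to the expansion of \<open>x\<close> in the basis \<open>B x, C\<close> of Cramer's rule.\<close>
    moreover have "cross2 (B *v x) C *\<^sub>R (B *v x) = 0"
      using BC BB[of x] by (simp add: coordinate_simps cross2_def) algebra
    ultimately show False using x by simp
  qed
  define c where "c = root 3 (1 / k\<^sup>2)"
  have c: "c > 0" "c ^ 3 * k\<^sup>2 = 1" using k by (simp_all add: c_def)
  have area: "cross2 (c\<^sup>2 *\<^sub>R (B *v C)) (c *\<^sub>R C) = c ^ 3 * k"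
    by (simp add: k_def power2_eq_square power3_eq_cube)
  have "(c ^ 3 * k)\<^sup>2 = c ^ 3 * (c ^ 3 * k\<^sup>2)" by (simp add: power2_eq_square)
  then have "(cross2 (c\<^sup>2 *\<^sub>R (B *v C)) (c *\<^sub>R C))\<^sup>2 = c ^ 3" unfolding area c by simp
  moreover have "cross2 (c\<^sup>2 *\<^sub>R (B *v C)) (c *\<^sub>R C) \<noteq> 0" unfolding area using c k by simp
  ultimately show ?thesis
    by (intro affine_image_solves_frame[OF X(1,2), of _ "c *\<^sub>R C" c _ _ _ _ 0])
       (simp_all add: matrix_vector_mult_scaleR BB power2_eq_square)
qed

lemma affine_image_solves_translation:
  assumes X: "plane_curve X" "soliton_eq (\<lambda>x. C) X" and "C \<noteq> 0"
  shows "affine_image_solves X (\<lambda>y. vec2 0 1)"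
proof -
  have X0: "soliton_eq (\<lambda>x. (0::real^2^2) *v x + C) X" using X by simp
  \<comment> \<open>The normal to \<open>C\<close> is scaled so that it spans unit area with \<open>C\<close>; here \<open>c = 1\<close>.\<close>
  define n where "n = C \<bullet> C"
  have n: "n \<noteq> 0" using assms by (simp add: n_def)
  have area: "cross2 (vec2 (C $ 2 / n) (- C $ 1 / n)) C = 1"
    using n by (simp add: cross2_def divide_simps) (simp add: n_def coordinate_simps)
  have "affine_image_solves X (\<lambda>y. mat22 0 0 0 0 *v y + vec2 0 1)"
    by (rule affine_image_solves_frame[OF X(1) X0, of "vec2 (C $ 2 / n) (- C $ 1 / n)" C 1 _ _ _ _ 0])
       (simp_all only: area, simp_all)
  moreover have "mat22 0 0 0 0 *v y + vec2 0 1 = vec2 0 1" for y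
    by (simp add: coordinate_simps)
  ultimately show ?thesis by simp
qed

text \<open>
  The squared sine of the angle from the tangent at \<open>u\<close> to the tangent at \<open>0\<close>, up to a constant
  factor, is the function \<open>g\<close> below; its derivative vanishes because the second derivative of \<open>X\<close> is
  parallel to the first.
\<close>

lemma zero_curvature_imp_constant_direction:
  assumes X: "plane_curve X" and flat: "\<And>u. cross2 (deriv1 X u) (deriv2 X u) = 0"
  shows "cross2 (deriv1 X u) (deriv1 X 0) = 0"
proof -
  define a b where "a = (\<lambda>u. deriv1 X u $ 1)" and "b = (\<lambda>u. deriv1 X u $ 2)"
  define a' b' where "a' = (\<lambda>u. deriv2 X u $ 1)" and "b' = (\<lambda>u. deriv2 X u $ 2)"
  define g where "g = (\<lambda>u. (a u * b 0 - b u * a 0)\<^sup>2 / ((a u)\<^sup>2 + (b u)\<^sup>2))"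
  have da: "(a has_field_derivative a' u) (at u)" and db: "(b has_field_derivative b' u) (at u)" for u
    using bounded_linear.has_vector_derivative[OF bounded_linear_vec_nth plane_curve_derivs(2)[OF X]]
    unfolding a_def b_def a'_def b'_def has_real_derivative_iff_has_vector_derivative by blast+
  have nz: "(a u)\<^sup>2 + (b u)\<^sup>2 \<noteq> 0" for u
    using plane_curve_derivs(3)[OF X, of u] by (auto simp: coordinate_simps a_def b_def sum_power2_eq_zero_iff)
  have "(g has_field_derivative 0) (at u)" for u
  proof -
    have ab: "a u * b' u = b u * a' u"
      using flat[of u] by (simp add: cross2_def a_def b_def a'_def b'_def)
    have "(2 * (a u * b 0 - b u * a 0) * (a' u * b 0 - b' u * a 0)) * ((a u)\<^sup>2 + (b u)\<^sup>2)
        - (a u * b 0 - b u * a 0)\<^sup>2 * (2 * a u * a' u + 2 * b u * b' u) = 0"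
      using ab by algebra
    then show ?thesis unfolding g_def using nz[of u]
      by (auto intro!: derivative_eq_intros da db simp: algebra_simps)
  qed
  then have "g u = g 0" using DERIV_isconst_all by blast
  moreover have "g 0 = 0" by (simp add: g_def)
  ultimately have "g u = 0" by simp
  then have "a u * b 0 - b u * a 0 = 0"
    using nz[of u] unfolding g_def by (metis divide_eq_0_iff power_eq_0_iff)
  then show ?thesis by (simp add: cross2_def a_def b_def)
qed

text \<open>
  For \<open>B = 0\<close> and \<open>C = 0\<close> the curve lies on a straight line. The field \<open>(0, 1)\<close> is not an affine
  image of the zero field, so the frame lemma does not apply; instead the line is turned until it is
  parallel to \<open>(0, 1)\<close>, so that the normal component of the field vanishes.
\<close>

lemma affine_image_solves_line:
  assumes X: "plane_curve X" "soliton_eq (\<lambda>x. 0) X"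
  shows "affine_image_solves X (\<lambda>y. vec2 0 1)"
proof -
  have flat: "cross2 (deriv1 X u) (deriv2 X u) = 0" for u
    using X(2) normal_speed_eq_iff[OF plane_curve_derivs(3)[OF X(1)], of 0 u]
    by (simp add: soliton_eq_def)
  define t where "t = deriv1 X 0"
  have t: "t \<noteq> 0" unfolding t_def by (rule plane_curve_derivs(3)[OF X(1)])
  \<comment> \<open>A rotation with dilation taking \<open>t\<close> to a vertical vector.\<close>
  define Q where "Q = mat22 (t $ 2) (- t $ 1) (t $ 1) (t $ 2)"
  have "det Q = (t $ 1)\<^sup>2 + (t $ 2)\<^sup>2" by (simp add: Q_def det_2 power2_eq_square)
  then have detQ: "det Q \<noteq> 0" using t by (simp add: coordinate_simps sum_power2_eq_zero_iff)
  have "soliton_eq (\<lambda>y. vec2 0 1) (\<lambda>u. Q *v X u + 0)"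
    unfolding soliton_eq_def
  proof
    fix u
    let ?Y = "\<lambda>u. Q *v X u + 0"
    have nz: "deriv1 ?Y u \<noteq> 0"
      unfolding affine_image_derivs[OF X(1)]
      using matrix_vector_mult_0_imp_0[OF detQ] plane_curve_derivs(3)[OF X(1)] by blast
    have "cross2 (Q *v deriv1 X u) (vec2 0 1) = cross2 (deriv1 X u) t"
      by (simp add: cross2_def Q_def coordinate_simps algebra_simps)
    also have "\<dots> = 0"
      using zero_curvature_imp_constant_direction[OF X(1) flat] by (simp add: t_def)
    finally have "cross2 (deriv1 ?Y u) (vec2 0 1) ^ 3 = cross2 (deriv1 ?Y u) (deriv2 ?Y u)"
      unfolding affine_image_derivs[OF X(1)] by (simp add: cross2_matrix_vector flat)
    then show "vec2 0 1 \<bullet> unit_normal ?Y u = root 3 (curvature ?Y u)"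
      using normal_speed_eq_iff[OF nz] by blast
  qed
  then show ?thesis unfolding affine_image_solves_def invertible_det_nz using detQ by blast
qed

section \<open>The classification\<close>

theorem theorem1p1:
  fixes X :: "real \<Rightarrow> real^2" and B :: "real^2^2" and C :: "real^2"
  assumes "affine_self_similar X"
    and "soliton_eq (\<lambda>x. B *v x + C) X"
  shows "\<exists>(Q::real^2^2) (H::real^2). invertible Q \<and>
    (let Y = (\<lambda>u. Q *v X u + H);
         R = range (\<lambda>x. B *v x);
         \<Delta> = (trace B)\<^sup>2 - 4 * det B;
         cases =
          [ \<comment> \<open>degenerate\<close>
           (det B = 0 \<and> B = 0,
              soliton_eq (\<lambda>y. vec2 0 1) Y),
           (det B = 0 \<and> B \<noteq> 0 \<and> (\<exists>l>0. eigenvalue B l) \<and> C \<in> R,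
              soliton_eq (\<lambda>y. mat22 0 0 0 1 *v y) Y),
           (det B = 0 \<and> B \<noteq> 0 \<and> (\<exists>l>0. eigenvalue B l) \<and> C \<notin> R,
              soliton_eq (\<lambda>y. mat22 0 0 0 1 *v y + vec2 1 0) Y),
           (det B = 0 \<and> B \<noteq> 0 \<and> (\<exists>l<0. eigenvalue B l) \<and> C \<in> R,
              soliton_eq (\<lambda>y. mat22 0 0 0 (-1) *v y) Y),
           (det B = 0 \<and> B \<noteq> 0 \<and> (\<exists>l<0. eigenvalue B l) \<and> C \<notin> R,
              soliton_eq (\<lambda>y. mat22 0 0 0 (-1) *v y + vec2 1 0) Y),
           (det B = 0 \<and> B \<noteq> 0 \<and> double_eigenvalue B 0 \<and> C \<in> R,
              soliton_eq (\<lambda>y. mat22 0 1 0 0 *v y) Y),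
           (det B = 0 \<and> B \<noteq> 0 \<and> double_eigenvalue B 0 \<and> C \<notin> R,
              soliton_eq (\<lambda>y. mat22 0 1 0 0 *v y + vec2 0 1) Y),
            \<comment> \<open>nondegenerate\<close>
           (det B \<noteq> 0 \<and> \<Delta> < 0 \<and> trace B = 0,
              soliton_eq (\<lambda>y. rotJ *v y) Y),
           (det B \<noteq> 0 \<and> \<Delta> < 0 \<and> trace B > 0,
              \<exists>a>0. soliton_eq (\<lambda>y. y + a *\<^sub>R (rotJ *v y)) Y),
           (det B \<noteq> 0 \<and> \<Delta> < 0 \<and> trace B < 0,
              \<exists>a>0. soliton_eq (\<lambda>y. - y + a *\<^sub>R (rotJ *v y)) Y),
           (det B \<noteq> 0 \<and> \<Delta> = 0 \<and> diagonalizable B \<and> (\<exists>l>0. double_eigenvalue B l),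
              soliton_eq (\<lambda>y. y) Y),
           (det B \<noteq> 0 \<and> \<Delta> = 0 \<and> diagonalizable B \<and> (\<exists>l<0. double_eigenvalue B l),
              soliton_eq (\<lambda>y. - y) Y),
           (det B \<noteq> 0 \<and> \<Delta> = 0 \<and> \<not> diagonalizable B \<and> (\<exists>l>0. double_eigenvalue B l),
              soliton_eq (\<lambda>y. mat22 1 1 0 1 *v y) Y),
           (det B \<noteq> 0 \<and> \<Delta> = 0 \<and> \<not> diagonalizable B \<and> (\<exists>l<0. double_eigenvalue B l),
              soliton_eq (\<lambda>y. mat22 (-1) 1 0 (-1) *v y) Y),
           (det B \<noteq> 0 \<and> \<Delta> > 0 \<and> det B > 0 \<and>
              (\<exists>l m. l \<noteq> m \<and> l > 0 \<and> m > 0 \<and> eigenvalue B l \<and> eigenvalue B m),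
              \<exists>a. 0 < a \<and> a < 1 \<and> soliton_eq (\<lambda>y. mat22 a 0 0 1 *v y) Y),
           (det B \<noteq> 0 \<and> \<Delta> > 0 \<and> det B > 0 \<and>
              (\<exists>l m. l \<noteq> m \<and> l < 0 \<and> m < 0 \<and> eigenvalue B l \<and> eigenvalue B m),
              \<exists>a. 0 < a \<and> a < 1 \<and> soliton_eq (\<lambda>y. - (mat22 a 0 0 1 *v y)) Y),
           (det B \<noteq> 0 \<and> \<Delta> > 0 \<and> det B < 0,
              \<exists>a>0. soliton_eq (\<lambda>y. mat22 (-a) 0 0 1 *v y) Y)]
     in (\<forall>(cond, eqn) \<in> set cases. cond \<longrightarrow> eqn) \<and>
        (\<exists>(cond, eqn) \<in> set cases. cond \<and> eqn))"
proof -
  define p where "p = trace B"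
  define D where "D = p\<^sup>2 - 4 * det B"
  note folds = p_def[symmetric] D_def[symmetric]
  have pc: "plane_curve X" using assms(1) by (simp add: affine_self_similar_def)
  note X = pc assms(2)
  note solves = affine_image_solves_def
  \<comment> \<open>Unless \<open>B\<close> is nilpotent, \<open>c\<close> is the inverse of the modulus of a real eigenvalue, or of the real or
    imaginary part of a complex one, so that this number is normalized to modulus \<open>1\<close>. The signs of \<open>p\<close>, \<open>D\<close> and the determinant then decide all listed conditions;
    each case also lists the negations that refute the others.\<close>
  consider (singular) "det B = 0" | (complex) "det B \<noteq> 0" "D < 0" "\<not> D > 0" "D \<noteq> 0" | (double) "det B \<noteq> 0" "D = 0"
    | (real) "det B \<noteq> 0" "D > 0" "\<not> D < 0" "D \<noteq> 0"
    by linarith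
  then show ?thesis
  proof cases
    case singular
    note signs = ex_eigenvalue_sign_singular[OF singular, folded p_def]
      double_eigenvalue_iff[of B 0, folded p_def] singular
    have eig: "eigenvalue B 0" "eigenvalue B p"
      by (simp_all add: eigenvalue_iff_root singular p_def power2_eq_square)
    show ?thesis
    proof (cases "B = 0")
      case True
      have C: "soliton_eq (\<lambda>x. C) X" using assms(2) True by simp
      have "affine_image_solves X (\<lambda>y. vec2 0 1)"
        using affine_image_solves_translation[OF pc C] affine_image_solves_line[OF pc] C
        by (cases "C = 0") auto
      then obtain Q H where QH: "invertible Q"
        "soliton_eq (\<lambda>y. vec2 0 1) (\<lambda>u. Q *v X u + H)"
        unfolding solves by blast
      show ?thesis unfolding Let_def folds
        using QH by (intro exI[of _ Q] exI[of _ H]) (simp add: singular[unfolded True] True)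
    next
      case B0: False
      consider (pos) "p > 0" "\<not> p < 0" "p \<noteq> 0" | (neg) "p < 0" "\<not> p > 0" "p \<noteq> 0" | (zero) "p = 0"
        by linarith
      then show ?thesis
      proof cases
        case pos
        show ?thesis
        proof (cases "C \<in> range (\<lambda>x. B *v x)")
          case C: True
          have "affine_image_solves X (\<lambda>y. mat22 0 0 0 1 *v y)"
            using affine_image_solves_diagonal[OF X C eig, of "1 / p"] pos by simp
          then obtain Q H where QH: "invertible Q"
            "soliton_eq (\<lambda>y. mat22 0 0 0 1 *v y) (\<lambda>u. Q *v X u + H)"
            unfolding solves by blast
          show ?thesis unfolding Let_def folds
            using QH by (intro exI[of _ Q] exI[of _ H]) (simp add: signs B0 C pos)
        next
          case C: False
          have "affine_image_solves X (\<lambda>y. mat22 0 0 0 1 *v y + vec2 1 0)"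
            using affine_image_solves_degenerate_translation[OF X C singular] pos
            by (simp add: p_def)
          then obtain Q H where QH: "invertible Q"
            "soliton_eq (\<lambda>y. mat22 0 0 0 1 *v y + vec2 1 0) (\<lambda>u. Q *v X u + H)"
            unfolding solves by blast
          show ?thesis unfolding Let_def folds
            using QH by (intro exI[of _ Q] exI[of _ H]) (simp add: signs B0 C pos)
        qed
      next
        case neg
        show ?thesis
        proof (cases "C \<in> range (\<lambda>x. B *v x)")
          case C: True
          have "affine_image_solves X (\<lambda>y. mat22 0 0 0 (-1) *v y)"
            using affine_image_solves_diagonal[OF X C eig, of "- 1 / p"] neg
            by (simp add: divide_pos_neg)
          then obtain Q H where QH: "invertible Q"
            "soliton_eq (\<lambda>y. mat22 0 0 0 (-1) *v y) (\<lambda>u. Q *v X u + H)"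
            unfolding solves by blast
          show ?thesis unfolding Let_def folds
            using QH by (intro exI[of _ Q] exI[of _ H]) (simp add: signs B0 C neg)
        next
          case C: False
          have "affine_image_solves X (\<lambda>y. mat22 0 0 0 (-1) *v y + vec2 1 0)"
            using affine_image_solves_degenerate_translation[OF X C singular] neg
            by (simp add: p_def)
          then obtain Q H where QH: "invertible Q"
            "soliton_eq (\<lambda>y. mat22 0 0 0 (-1) *v y + vec2 1 0) (\<lambda>u. Q *v X u + H)"
            unfolding solves by blast
          show ?thesis unfolding Let_def folds
            using QH by (intro exI[of _ Q] exI[of _ H]) (simp add: signs B0 C neg)
        qed
      next
        case zero
        show ?thesis
        proof (cases "C \<in> range (\<lambda>x. B *v x)")
          case C: True
          have "affine_image_solves X (\<lambda>y. mat22 0 1 0 0 *v y)"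
            using affine_image_solves_Jordan[OF X C, of 0 1] zero singular B0 by (simp add: p_def)
          then obtain Q H where QH: "invertible Q"
            "soliton_eq (\<lambda>y. mat22 0 1 0 0 *v y) (\<lambda>u. Q *v X u + H)"
            unfolding solves by blast
          show ?thesis unfolding Let_def folds
            using QH by (intro exI[of _ Q] exI[of _ H]) (simp add: signs B0 C zero)
        next
          case C: False
          have "affine_image_solves X (\<lambda>y. mat22 0 1 0 0 *v y + vec2 0 1)"
            using affine_image_solves_nilpotent_translation[OF X C singular] zero B0
            by (simp add: p_def)
          then obtain Q H where QH: "invertible Q"
            "soliton_eq (\<lambda>y. mat22 0 1 0 0 *v y + vec2 0 1) (\<lambda>u. Q *v X u + H)"
            unfolding solves by blast
          show ?thesis unfolding Let_def folds
            using QH by (intro exI[of _ Q] exI[of _ H]) (simp add: signs B0 C zero)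
        qed
      qed
    qed
  next
    case complex
    note C = range_nonsingular[OF complex(1)]
    obtain b where b: "b > 0" "\<And>c. c > 0 \<Longrightarrow> affine_image_solves X
        (\<lambda>y. mat22 (c * (p / 2)) (- (c * b)) (c * b) (c * (p / 2)) *v y)"
      using affine_image_solves_complex[OF X C] complex(2) unfolding folds by blast
    consider (pos) "p > 0" "\<not> p < 0" "p \<noteq> 0" | (neg) "p < 0" "\<not> p > 0" "p \<noteq> 0" | (zero) "p = 0"
      by linarith
    then show ?thesis
    proof cases
      case zero
      have "affine_image_solves X (\<lambda>y. rotJ *v y)"
        using b(2)[of "1 / b"] b(1) by (simp add: zero rotJ_def)
      then obtain Q H where QH: "invertible Q"
        "soliton_eq (\<lambda>y. rotJ *v y) (\<lambda>u. Q *v X u + H)"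
        unfolding solves by blast
      show ?thesis unfolding Let_def folds
        using QH by (intro exI[of _ Q] exI[of _ H]) (simp add: complex zero)
    next
      case pos
      define a where "a = 2 * b / p"
      have a: "a > 0" using b(1) pos by (simp add: a_def)
      have "mat22 1 (- a) a 1 *v y = y + a *\<^sub>R (rotJ *v y)" for y
        by (simp add: coordinate_simps rotJ_def)
      then have "affine_image_solves X (\<lambda>y. y + a *\<^sub>R (rotJ *v y))"
        using b(2)[of "2 / p"] pos by (simp add: a_def)
      then obtain Q H where QH: "invertible Q"
        "soliton_eq (\<lambda>y. y + a *\<^sub>R (rotJ *v y)) (\<lambda>u. Q *v X u + H)"
        unfolding solves by blast
      show ?thesis unfolding Let_def folds
        using QH a by (intro exI[of _ Q] exI[of _ H]) (auto simp: complex pos)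
    next
      case neg
      define a where "a = - 2 * b / p"
      have a: "a > 0" using b(1) neg by (simp add: a_def divide_less_0_iff)
      have "mat22 (-1) (- a) a (-1) *v y = - y + a *\<^sub>R (rotJ *v y)" for y
        by (simp add: coordinate_simps rotJ_def)
      then have "affine_image_solves X (\<lambda>y. - y + a *\<^sub>R (rotJ *v y))"
        using b(2)[of "- 2 / p"] neg by (simp add: a_def divide_pos_neg)
      then obtain Q H where QH: "invertible Q"
        "soliton_eq (\<lambda>y. - y + a *\<^sub>R (rotJ *v y)) (\<lambda>u. Q *v X u + H)"
        unfolding solves by blast
      show ?thesis unfolding Let_def folds
        using QH a by (intro exI[of _ Q] exI[of _ H]) (auto simp: complex neg)
    qed
  next
    case double
    note C = range_nonsingular[OF double(1)]
    have disc: "(trace B)\<^sup>2 - 4 * det B = 0" using double(2) unfolding folds .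
    note signs = ex_double_eigenvalue_sign[OF disc, folded p_def]
    have diag: "diagonalizable B \<longleftrightarrow> B = (p / 2) *\<^sub>R mat 1"
      using diagonalizable_double_root_iff[of B] disc by (simp add: p_def)
    have half: "p / 2 = trace B / 2" by (simp add: p_def)
    have "p \<noteq> 0" using double by (auto simp: D_def)
    then consider (pos) "p > 0" "\<not> p < 0" | (neg) "p < 0" "\<not> p > 0" by linarith
    then show ?thesis
    proof cases
      case pos
      show ?thesis
      proof (cases "diagonalizable B")
        case True
        have "mat22 1 0 0 1 *v y = y" for y by (simp add: coordinate_simps)
        then have "affine_image_solves X (\<lambda>y. y)"
          using affine_image_solves_scalar[OF X C, of "p / 2" "2 / p"] True diag pos by simp
        then obtain Q H where QH: "invertible Q"
          "soliton_eq (\<lambda>y. y) (\<lambda>u. Q *v X u + H)"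
          unfolding solves by blast
        show ?thesis unfolding Let_def folds
          using QH by (intro exI[of _ Q] exI[of _ H]) (simp add: double signs True pos)
      next
        case False
        have "affine_image_solves X (\<lambda>y. mat22 1 1 0 1 *v y)"
          using affine_image_solves_Jordan[OF X C disc half, of "2 / p"] False diag pos by simp
        then obtain Q H where QH: "invertible Q"
          "soliton_eq (\<lambda>y. mat22 1 1 0 1 *v y) (\<lambda>u. Q *v X u + H)"
          unfolding solves by blast
        show ?thesis unfolding Let_def folds
          using QH by (intro exI[of _ Q] exI[of _ H]) (simp add: double signs False pos)
      qed
    next
      case neg
      show ?thesis
      proof (cases "diagonalizable B")
        case True
        have "mat22 (-1) 0 0 (-1) *v y = - y" for y by (simp add: coordinate_simps)
        then have "affine_image_solves X (\<lambda>y. - y)"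
          using affine_image_solves_scalar[OF X C, of "p / 2" "- 2 / p"] True diag neg
          by (simp add: divide_pos_neg)
        then obtain Q H where QH: "invertible Q"
          "soliton_eq (\<lambda>y. - y) (\<lambda>u. Q *v X u + H)"
          unfolding solves by blast
        show ?thesis unfolding Let_def folds
          using QH by (intro exI[of _ Q] exI[of _ H]) (simp add: double signs True neg)
      next
        case False
        have "affine_image_solves X (\<lambda>y. mat22 (-1) 1 0 (-1) *v y)"
          using affine_image_solves_Jordan[OF X C disc half, of "- 2 / p"] False diag neg
          by (simp add: divide_pos_neg)
        then obtain Q H where QH: "invertible Q"
          "soliton_eq (\<lambda>y. mat22 (-1) 1 0 (-1) *v y) (\<lambda>u. Q *v X u + H)"
          unfolding solves by blast
        show ?thesis unfolding Let_def folds
          using QH by (intro exI[of _ Q] exI[of _ H]) (simp add: double signs False neg)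
      qed
    qed
  next
    case real
    note C = range_nonsingular[OF real(1)]
    have disc: "(trace B)\<^sup>2 - 4 * det B > 0" using real(2) unfolding folds .
    obtain l m where lm: "l < m" "l + m = p" "l * m = det B"
      and eig: "eigenvalue B l" "eigenvalue B m"
      using distinct_eigenvalues[OF disc] unfolding p_def by metis
    consider (opposite) "det B < 0" "\<not> det B > 0"
      | (pos) "det B > 0" "p > 0" "\<not> det B < 0" "\<not> p < 0"
      | (neg) "det B > 0" "p \<le> 0" "\<not> det B < 0" "\<not> p > 0"
      using real(1) by linarith
    then show ?thesis
    proof cases
      case opposite
      have "l < 0" "m > 0" using lm(1) opposite unfolding lm(3)[symmetric] mult_less_0_iff by auto
      define a where "a = - l / m"
      have a: "a > 0" using \<open>l < 0\<close> \<open>m > 0\<close> by (simp add: a_def divide_neg_pos)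
      have "affine_image_solves X (\<lambda>y. mat22 (- a) 0 0 1 *v y)"
        using affine_image_solves_diagonal[OF X C eig, of "1 / m"] lm(1) \<open>m > 0\<close>
        by (simp add: a_def)
      then obtain Q H where QH: "invertible Q"
        "soliton_eq (\<lambda>y. mat22 (- a) 0 0 1 *v y) (\<lambda>u. Q *v X u + H)"
        unfolding solves by blast
      show ?thesis unfolding Let_def folds
        using QH a opposite by (intro exI[of _ Q] exI[of _ H]) (auto simp: real opposite)
    next
      case pos
      have "l > 0" "m > 0" using lm(1,2) pos unfolding lm(3)[symmetric] zero_less_mult_iff by auto
      define a where "a = l / m"
      have a: "0 < a" "a < 1" using \<open>l > 0\<close> \<open>m > 0\<close> lm(1) by (simp_all add: a_def)
      have "affine_image_solves X (\<lambda>y. mat22 a 0 0 1 *v y)"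
        using affine_image_solves_diagonal[OF X C eig, of "1 / m"] lm(1) \<open>m > 0\<close>
        by (simp add: a_def)
      then obtain Q H where QH: "invertible Q"
        "soliton_eq (\<lambda>y. mat22 a 0 0 1 *v y) (\<lambda>u. Q *v X u + H)"
        unfolding solves by blast
      show ?thesis unfolding Let_def folds
        using QH a by (intro exI[of _ Q] exI[of _ H]) (auto simp: real pos ex_two_eigenvalues_sign[OF disc pos(1), folded p_def])
    next
      case neg
      have "l < 0" "m < 0" using lm(1,2) neg unfolding lm(3)[symmetric] zero_less_mult_iff by auto
      then have p: "p < 0" using lm(2) by simp
      \<comment> \<open>The eigenvalue \<open>l\<close> of larger modulus is normalized to \<open>-1\<close>, so that the quotient is below \<open>1\<close>.\<close>
      define a where "a = m / l"
      have a: "0 < a" "a < 1"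
        using \<open>l < 0\<close> \<open>m < 0\<close> lm(1) by (simp_all add: a_def divide_neg_neg divide_less_eq)
      have "mat22 (- a) 0 0 (-1) *v y = - (mat22 a 0 0 1 *v y)" for y
        by (simp add: coordinate_simps)
      then have "affine_image_solves X (\<lambda>y. - (mat22 a 0 0 1 *v y))"
        using affine_image_solves_diagonal[OF X C eig(2,1), of "- 1 / l"] lm(1) \<open>l < 0\<close>
        by (simp add: a_def divide_pos_neg)
      then obtain Q H where QH: "invertible Q"
        "soliton_eq (\<lambda>y. - (mat22 a 0 0 1 *v y)) (\<lambda>u. Q *v X u + H)"
        unfolding solves by blast
      show ?thesis unfolding Let_def folds
        using QH a by (intro exI[of _ Q] exI[of _ H]) (auto simp: real neg p ex_two_eigenvalues_sign[OF disc neg(1), folded p_def])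
    qed
  qed
qed

end
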